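(* Let $\mathbb{X}$ be a Euclidean space and let $f,g:\mathbb{X}\to\mathbb{R}\cup\{+\infty\}$ be proper functions such that $\operatorname{int}(\operatorname{dom} f)\cap \operatorname{dom} g\neq\emptyset$, $f$ is twice continuously differentiable in $\operatorname{int}(\operatorname{dom} f)$, and $g$ is lower semicontinuous. Consider the problem $\min_{x\in\mathbb{X}} \varphi(x):=f(x)+g(x)$. Let $\bar x\in \operatorname{int}(\operatorname{dom} f)\cap\operatorname{dom} g$ be a stationary point of this problem, i.e. $\bar v:=-\nabla f(\bar x)\in\partial g(\bar x)$. Let $S(\bar x,\bar v):=\{x\in\mathbb{X}\mid g(x)-\langle \bar v,x\rangle\le g(\bar x)-\langle\bar v,\bar x\rangle\}$. (1) If $\bar x$ is a strong solution of the problem, then $$\langle \nabla^2 f(\bar x)w,w\rangle>0\quad\text{for all } w\in T_{S(\bar x,\bar v)}(\bar x)\setminus\{0\}.$$ (2) Suppose further that $g$ satisfies the quadratic growth condition at $\bar x$ for $\bar v$ and that $\nabla^2 f(\bar x)$ is positive semidefinite. Then $\bar x$ is a strong solution of the problem if and only if $$\operatorname{Ker}\nabla^2 f(\bar x)\cap T_{S(\bar x,\bar v)}(\bar x)=\{0\}.$$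
   Context: $\partial g$ denotes the Mordukhovich limiting subdifferential: $v\in\partial g(\bar x)$ iff there are sequences $x_k\to\bar x$ with $g(x_k)\to g(\bar x)$ and $v_k\to v$ with $\liminf_{x\to x_k}\frac{g(x)-g(x_k)-\langle v_k,x-x_k\rangle}{\|x-x_k\|}\ge 0$ for every $k$. A point $\bar x\in\operatorname{dom}\varphi$ is a strong solution of $\varphi$ if there exist $c,\varepsilon>0$ such that $\varphi(x)-\varphi(\bar x)\ge c\|x-\bar x\|^2$ for all $x$ in the closed ball $\mathbb{B}_\varepsilon(\bar x)$. The (Bouligand) contingent cone to a closed set $K$ at $\bar x\in K$ is $T_K(\bar x)=\{w\mid \exists\, t_k\downarrow 0,\ w_k\to w,\ \bar x+t_kw_k\in K\}$. $g$ satisfies the quadratic growth condition at $\bar x$ for $\bar v\in\partial g(\bar x)$ if there exist $\varepsilon,\delta,\kappa>0$ such that $g(x)-g(\bar x)-\langle\bar v,x-\bar x\rangle\ge\frac{\kappa}{2}[\operatorname{dist}(x;S(\bar x,\bar v))]^2$ for all $x\in\mathbb{B}_\varepsilon(\bar x)$ with $g(x)-g(\bar x)-\langle\bar v,x-\bar x\rangle<\delta$. *)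

theory Defs
  imports "HOL-Analysis.Analysis"
begin

definition effective_domain :: "('a \<Rightarrow> ereal) \<Rightarrow> 'a set" where
  "effective_domain g = {x. g x < \<infinity>}"

definition proper_fun :: "('a \<Rightarrow> ereal) \<Rightarrow> bool" where
  "proper_fun g \<longleftrightarrow> (\<forall>x. g x \<noteq> -\<infinity>) \<and> effective_domain g \<noteq> {}"

definition lower_semicontinuous :: "('a::topological_space \<Rightarrow> ereal) \<Rightarrow> bool" where
  "lower_semicontinuous g \<longleftrightarrow> (\<forall>x. g x \<le> Liminf (at x) g)"

definition gradient :: "('a::euclidean_space \<Rightarrow> real) \<Rightarrow> 'a \<Rightarrow> 'a" where
  "gradient h x = (THE d. GDERIV h x :> d)"

definition hessian :: "('a::euclidean_space \<Rightarrow> real) \<Rightarrow> 'a \<Rightarrow> 'a \<Rightarrow>\<^sub>L 'a" where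
  "hessian h x = Blinfun (frechet_derivative (gradient h) (at x))"

definition twice_continuously_differentiable_on ::
    "('a::euclidean_space \<Rightarrow> real) \<Rightarrow> 'a set \<Rightarrow> bool" where
  "twice_continuously_differentiable_on h U \<longleftrightarrow>
     (\<forall>x\<in>U. h differentiable (at x)) \<and>
     (\<forall>x\<in>U. gradient h differentiable (at x)) \<and>
     continuous_on U (hessian h)"

lemma gradient_eqI:
  assumes "GDERIV h x :> d"
  shows "gradient h x = d"
  unfolding gradient_def
proof (rule the_equality)
  show "GDERIV h x :> d" by (rule assms)
next
  fix e assume "GDERIV h x :> e"
  with assms have "(\<lambda>y. inner y e) = (\<lambda>y. inner y d)"
    unfolding gderiv_def by (rule has_derivative_unique[rotated])
  then show "e = d"
    by (metis inner_commute vector_eq_rdot)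
qed

lemma gderiv_gradient:
  fixes h :: "'a::euclidean_space \<Rightarrow> real"
  assumes "h differentiable (at x)"
  shows "GDERIV h x :> gradient h x"
proof -
  obtain D where D: "(h has_derivative D) (at x)"
    using assms unfolding differentiable_def by blast
  then interpret linear D
    by (rule has_derivative_linear)
  have "D = (\<lambda>y. inner y (adjoint D 1))"
    using adjoint_works[of D] linear_axioms by (auto simp: fun_eq_iff)
  with D have "GDERIV h x :> adjoint D 1"
    unfolding gderiv_def by simp
  then show ?thesis
    using gradient_eqI by metis
qed

lemma has_derivative_hessian:
  assumes "gradient h differentiable (at x)"
  shows "(gradient h has_derivative blinfun_apply (hessian h x)) (at x)"
  unfolding hessian_def
  using assms frechet_derivative_works has_derivative_bounded_linear
  by (metis bounded_linear_Blinfun_apply)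

text \<open>The finiteness conditions in the next two definitions express the convention that both
  subdifferentials are empty outside the effective domain; they also keep the extended-real
  differences free of \<open>\<infinity> - \<infinity>\<close>.\<close>

definition regular_subdifferential :: "('a::euclidean_space \<Rightarrow> ereal) \<Rightarrow> 'a \<Rightarrow> 'a set" where
  "regular_subdifferential g x =
     {v. \<bar>g x\<bar> \<noteq> \<infinity> \<and>
         0 \<le> Liminf (at x) (\<lambda>y. (g y - g x - ereal (inner v (y - x))) / ereal (norm (y - x)))}"

definition limiting_subdifferential :: "('a::euclidean_space \<Rightarrow> ereal) \<Rightarrow> 'a \<Rightarrow> 'a set" where
  "limiting_subdifferential g x =
     {v. \<bar>g x\<bar> \<noteq> \<infinity> \<and>
         (\<exists>xs vs. xs \<longlonglongrightarrow> x \<and> (\<lambda>k. g (xs k)) \<longlonglongrightarrow> g x \<and> vs \<longlonglongrightarrow> v \<and>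
            (\<forall>k. vs k \<in> regular_subdifferential g (xs k)))}"

definition strong_solution :: "('a::euclidean_space \<Rightarrow> ereal) \<Rightarrow> 'a \<Rightarrow> bool" where
  "strong_solution \<phi> xbar \<longleftrightarrow>
     xbar \<in> effective_domain \<phi> \<and>
     (\<exists>c \<epsilon>. c > 0 \<and> \<epsilon> > 0 \<and>
        (\<forall>x\<in>cball xbar \<epsilon>. \<phi> x - \<phi> xbar \<ge> ereal (c * (norm (x - xbar))\<^sup>2)))"

definition contingent_cone :: "'a::euclidean_space set \<Rightarrow> 'a \<Rightarrow> 'a set" where
  "contingent_cone K xbar =
     {w. \<exists>t ws. (\<forall>k::nat. t k > (0::real)) \<and> t \<longlonglongrightarrow> 0 \<and> ws \<longlonglongrightarrow> w \<and>
           (\<forall>k. xbar + t k *\<^sub>R ws k \<in> K)}"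

definition solution_set :: "('a::euclidean_space \<Rightarrow> ereal) \<Rightarrow> 'a \<Rightarrow> 'a \<Rightarrow> 'a set" where
  "solution_set g xbar vbar =
     {x. g x - ereal (inner vbar x) \<le> g xbar - ereal (inner vbar xbar)}"

definition quadratic_growth :: "('a::euclidean_space \<Rightarrow> ereal) \<Rightarrow> 'a \<Rightarrow> 'a \<Rightarrow> bool" where
  "quadratic_growth g xbar vbar \<longleftrightarrow>
     (\<exists>\<epsilon> \<delta> \<kappa>. \<epsilon> > 0 \<and> \<delta> > 0 \<and> \<kappa> > 0 \<and>
        (\<forall>x\<in>cball xbar \<epsilon>.
           g x - g xbar - ereal (inner vbar (x - xbar)) < ereal \<delta> \<longrightarrow>
           g x - g xbar - ereal (inner vbar (x - xbar))
             \<ge> ereal (\<kappa> / 2 * (infdist x (solution_set g xbar vbar))\<^sup>2)))"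

text \<open>Symmetry is not part of this definition: the Hessian of a twice continuously
  differentiable function is self-adjoint anyway.\<close>

definition positive_semidefinite :: "('a::euclidean_space \<Rightarrow>\<^sub>L 'a) \<Rightarrow> bool" where
  "positive_semidefinite H \<longleftrightarrow> (\<forall>w. 0 \<le> inner (blinfun_apply H w) w)"

definition Ker :: "('a::real_normed_vector \<Rightarrow>\<^sub>L 'b::real_normed_vector) \<Rightarrow> 'a set" where
  "Ker H = {w. blinfun_apply H w = 0}"

end

theory Submission
  imports Defs
begin

text \<open>Stationarity cancels the first-order terms: strong growth of \<open>f + g\<close> says that the gap
  \<open>g x - g xbar - \<langle>vbar, x - xbar\<rangle>\<close> is at least \<open>c |x - xbar|\<^sup>2 - \<langle>A (x - xbar), x - xbar\<rangle> / 2\<close> up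
  to \<open>o(|x - xbar|\<^sup>2)\<close>, where \<open>A\<close> is the Hessian of \<open>f\<close> at \<open>xbar\<close>. The gap is nonpositive on
  the solution set, so \<open>\<langle>A w, w\<rangle> \<ge> 2 c |w|\<^sup>2\<close> for contingent directions \<open>w\<close>. For the converse,
  the kernel enters because a self-adjoint positive semidefinite \<open>A\<close> has \<open>\<langle>A w, w\<rangle> = 0\<close> only if
  \<open>A w = 0\<close>.\<close>

section \<open>Second-order Taylor estimates from differentiability of the gradient at one
  point\<close>

lemma gradient_linear_approx:
  fixes G :: "'a::euclidean_space \<Rightarrow> 'a"
  assumes "open U" "x \<in> U" "(G has_derivative A) (at x)" "e > 0"
  obtains d where "d > 0"
    "\<And>h. norm h < d \<Longrightarrow> x + h \<in> U"
    "\<And>h. norm h < d \<Longrightarrow> norm (G (x + h) - G x - A h) \<le> e * norm h"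
proof -
  obtain d1 where "d1 > 0" "ball x d1 \<subseteq> U"
    using assms openE by blast
  moreover obtain d2 where "d2 > 0"
    "\<And>y. norm (y - x) < d2 \<Longrightarrow> norm (G y - G x - A (y - x)) \<le> e * norm (y - x)"
    using assms unfolding has_derivative_at_alt by blast
  from this(2)[of "x + _"] have "norm h < d2 \<Longrightarrow> norm (G (x + h) - G x - A h) \<le> e * norm h" for h
    by simp
  ultimately show thesis
    using \<open>d2 > 0\<close> by (intro that[of "min d1 d2"]) (auto simp: subset_iff dist_norm)
qed

lemma GDERIV_line:
  assumes "GDERIV F (a + \<tau> *\<^sub>R h) :> D"
  shows "((\<lambda>\<tau>. F (a + \<tau> *\<^sub>R h)) has_real_derivative inner D h) (at \<tau>)"
proof -
  have "((\<lambda>\<tau>. a + \<tau> *\<^sub>R h) has_derivative (\<lambda>s. s *\<^sub>R h)) (at \<tau>)"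
    by (auto intro!: derivative_eq_intros)
  from has_derivative_compose[OF this assms[unfolded gderiv_def]]
  show ?thesis
    by (simp add: has_field_derivative_def inner_commute mult.commute[of "inner D h"] mult_commute_abs)
qed

text \<open>The gradient is differentiable at \<open>x\<close> alone, so \<open>F\<close> minus its
  quadratic model is treated by the mean value theorem on the segment: its derivative is the
  linearisation error of \<open>G\<close> paired with \<open>h\<close>, hence at most
  \<open>e\<close> times the squared norm of \<open>h\<close>.\<close>

lemma second_order_expansion:
  fixes F :: "'a::euclidean_space \<Rightarrow> real"
  assumes "open U" "x \<in> U" and F: "\<And>y. y \<in> U \<Longrightarrow> GDERIV F y :> G y"
    and G: "(G has_derivative A) (at x)" and "e > 0"
  obtains d where "d > 0"
    "\<And>h. norm h < d \<Longrightarrow>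
       \<bar>F (x + h) - F x - inner (G x) h - inner (A h) h / 2\<bar> \<le> e * (norm h)\<^sup>2"
proof -
  interpret A: bounded_linear A using G by (rule has_derivative_bounded_linear)
  obtain d where d: "d > 0" "\<And>h. norm h < d \<Longrightarrow> x + h \<in> U"
    "\<And>h. norm h < d \<Longrightarrow> norm (G (x + h) - G x - A h) \<le> e * norm h"
    using gradient_linear_approx[OF assms(1,2) G \<open>e > 0\<close>] by blast
  have "\<bar>F (x + h) - F x - inner (G x) h - inner (A h) h / 2\<bar> \<le> e * (norm h)\<^sup>2"
    if h: "norm h < d" for h
  proof -
    \<comment> \<open>\<open>q 1 - q 0\<close> is exactly the remainder to be bounded.\<close>
    define q where "q \<tau> = F (x + \<tau> *\<^sub>R h) - \<tau> * inner (G x) h - \<tau>\<^sup>2 / 2 * inner (A h) h" for \<tau>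
    define q' where "q' \<tau> = inner (G (x + \<tau> *\<^sub>R h) - G x - A (\<tau> *\<^sub>R h)) h" for \<tau>
    have small: "norm (\<tau> *\<^sub>R h) < d" if "0 \<le> \<tau>" "\<tau> \<le> 1" for \<tau>
      using h that mult_right_mono[of \<tau> 1 "norm h"] by auto
    have "(q has_real_derivative q' \<tau>) (at \<tau>)" if "0 \<le> \<tau>" "\<tau> \<le> 1" for \<tau>
      unfolding q_def q'_def
      by (rule derivative_eq_intros GDERIV_line[OF F[OF d(2)[OF small[OF that]]]] refl | simp)+
        (simp add: A.scaleR inner_diff_left)
    then obtain \<tau> where \<tau>: "0 < \<tau>" "\<tau> < 1" "q 1 - q 0 = q' \<tau>"
      using MVT2[of 0 1 q q'] by auto
    have "\<bar>q' \<tau>\<bar> \<le> norm (G (x + \<tau> *\<^sub>R h) - G x - A (\<tau> *\<^sub>R h)) * norm h"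
      unfolding q'_def by (rule Cauchy_Schwarz_ineq2)
    also have "\<dots> \<le> e * norm (\<tau> *\<^sub>R h) * norm h"
      using d(3)[OF small, of \<tau>] \<tau> by (intro mult_right_mono) auto
    also have "\<dots> \<le> e * norm h * norm h"
      using \<tau> \<open>e > 0\<close> by (intro mult_right_mono mult_left_mono) (auto simp: mult_left_le_one_le)
    finally show ?thesis
      using \<tau>(3) by (simp add: q_def power2_eq_square algebra_simps)
  qed
  with d(1) show thesis by (rule that)
qed

text \<open>Division by \<open>(t k)\<^sup>2\<close> turns the quadratic error of the expansion into
  \<open>e * (norm (ws k))\<^sup>2\<close>, which is uniformly small because the convergent sequence
  \<open>ws\<close> is bounded.\<close>

lemma second_order_quotient_tendsto:
  fixes F :: "'a::euclidean_space \<Rightarrow> real" and t :: "nat \<Rightarrow> real"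
  assumes "open U" "x \<in> U" and "\<And>y. y \<in> U \<Longrightarrow> GDERIV F y :> G y"
    and G: "(G has_derivative A) (at x)"
    and t: "\<And>k. t k > 0" "t \<longlonglongrightarrow> 0" and ws: "ws \<longlonglongrightarrow> w"
  shows "(\<lambda>k. (F (x + t k *\<^sub>R ws k) - F x - inner (G x) (t k *\<^sub>R ws k)) / (t k)\<^sup>2)
           \<longlonglongrightarrow> inner (A w) w / 2"
proof -
  interpret A: bounded_linear A using G by (rule has_derivative_bounded_linear)
  define rem where "rem k = (F (x + t k *\<^sub>R ws k) - F x - inner (G x) (t k *\<^sub>R ws k)) / (t k)\<^sup>2
    - inner (A (ws k)) (ws k) / 2" for k
  obtain B where B: "B > 0" "\<And>k. norm (ws k) \<le> B"
    using ws convergent_imp_Bseq[of ws] convergentI BseqE by metis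
  have tw: "(\<lambda>k. t k *\<^sub>R ws k) \<longlonglongrightarrow> 0"
    using tendsto_scaleR[OF t(2) ws] by simp
  have "rem \<longlonglongrightarrow> 0"
  proof (rule LIMSEQ_I)
    fix r :: real assume "r > 0"
    \<comment> \<open>With this choice \<open>e * B\<^sup>2\<close> equals
      \<open>r / 2\<close>.\<close>
    define e where "e = r / (2 * B\<^sup>2)"
    have "e > 0" using \<open>r > 0\<close> B by (simp add: e_def)
    obtain d where d: "d > 0" "\<And>h. norm h < d \<Longrightarrow>
       \<bar>F (x + h) - F x - inner (G x) h - inner (A h) h / 2\<bar> \<le> e * (norm h)\<^sup>2"
      using second_order_expansion[OF assms(1-4) \<open>e > 0\<close>] by blast
    obtain N where N: "\<And>k. k \<ge> N \<Longrightarrow> norm (t k *\<^sub>R ws k) < d"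
      using LIMSEQ_D[OF tw \<open>d > 0\<close>] by auto
    have "norm (rem k - 0) < r" if "k \<ge> N" for k
    proof -
      have "rem k * (t k)\<^sup>2 = F (x + t k *\<^sub>R ws k) - F x - inner (G x) (t k *\<^sub>R ws k)
          - inner (A (t k *\<^sub>R ws k)) (t k *\<^sub>R ws k) / 2"
        using t(1)[of k]
        by (simp add: rem_def A.scaleR power2_eq_square field_simps)
      then have "\<bar>rem k * (t k)\<^sup>2\<bar> \<le> e * (norm (t k *\<^sub>R ws k))\<^sup>2"
        using d(2)[OF N[OF that]] by simp
      then have "\<bar>rem k\<bar> * (t k)\<^sup>2 \<le> (e * (norm (ws k))\<^sup>2) * (t k)\<^sup>2"
        by (simp add: abs_mult power_mult_distrib mult_ac)
      then have "\<bar>rem k\<bar> \<le> e * (norm (ws k))\<^sup>2"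
        using t(1)[of k] by simp
      also have "\<dots> \<le> e * B\<^sup>2"
        using B(2)[of k] \<open>e > 0\<close> by (intro mult_left_mono power_mono) auto
      also have "\<dots> < r"
        using \<open>r > 0\<close> B(1) by (simp add: e_def)
      finally show ?thesis by simp
    qed
    then show "\<exists>N. \<forall>k\<ge>N. norm (rem k - 0) < r" by blast
  qed
  moreover have "(\<lambda>k. inner (A (ws k)) (ws k) / 2) \<longlonglongrightarrow> inner (A w) w / 2"
    by (intro tendsto_intros A.tendsto ws) simp
  ultimately have "(\<lambda>k. rem k + inner (A (ws k)) (ws k) / 2) \<longlonglongrightarrow> 0 + inner (A w) w / 2"
    by (rule tendsto_add)
  then show ?thesis by (simp add: rem_def)
qed

section \<open>Self-adjointness of the Hessian and null vectors of semidefinite forms\<close>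

text \<open>The mean value theorem is applied to the difference in direction \<open>u\<close> as a
  function of the step along \<open>w\<close>. Its derivative compares \<open>G\<close> at two
  points; both values are linearised around \<open>x\<close>, and the two errors produce the factor
  2.\<close>

lemma second_difference_estimate:
  fixes F :: "'a::euclidean_space \<Rightarrow> real"
  assumes F: "\<And>h. norm h < d \<Longrightarrow> GDERIV F (x + h) :> G (x + h)"
    and G: "\<And>h. norm h < d \<Longrightarrow> norm (G (x + h) - G x - A h) \<le> e * norm h"
    and uw: "norm u + norm w < d" and "e > 0" and "linear A"
  shows "\<bar>F (x + u + w) - F (x + u) - F (x + w) + F x - inner (A u) w\<bar>
           \<le> 2 * e * (norm u + norm w) * norm w"
proof -
  interpret A: linear A by fact
  define q where "q \<tau> = F ((x + u) + \<tau> *\<^sub>R w) - F (x + \<tau> *\<^sub>R w) - \<tau> * inner (A u) w" for \<tau>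
  \<comment> \<open>The linear parts satisfy
    \<open>A (u + \<tau> *\<^sub>R w) - A (\<tau> *\<^sub>R w) = A u\<close>, so this expression is
    the derivative of \<open>q\<close>.\<close>
  define q' where "q' \<tau> = inner ((G (x + (u + \<tau> *\<^sub>R w)) - G x - A (u + \<tau> *\<^sub>R w))
     - (G (x + \<tau> *\<^sub>R w) - G x - A (\<tau> *\<^sub>R w))) w" for \<tau>
  have le: "norm (\<tau> *\<^sub>R w) \<le> norm w" "norm (u + \<tau> *\<^sub>R w) \<le> norm u + norm w"
    if "0 \<le> \<tau>" "\<tau> \<le> 1" for \<tau>
  proof -
    show *: "norm (\<tau> *\<^sub>R w) \<le> norm w"
      using that by (simp add: mult_left_le_one_le)
    show "norm (u + \<tau> *\<^sub>R w) \<le> norm u + norm w"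
      using norm_triangle_ineq[of u "\<tau> *\<^sub>R w"] * by linarith
  qed
  have small: "norm (\<tau> *\<^sub>R w) < d" "norm (u + \<tau> *\<^sub>R w) < d" if "0 \<le> \<tau>" "\<tau> \<le> 1" for \<tau>
    using le[OF that] uw norm_ge_zero[of u] by linarith+
  have "(q has_real_derivative q' \<tau>) (at \<tau>)" if "0 \<le> \<tau>" "\<tau> \<le> 1" for \<tau>
  proof -
    have "GDERIV F ((x + u) + \<tau> *\<^sub>R w) :> G (x + (u + \<tau> *\<^sub>R w))"
      using F[OF small(2)[OF that]] by (simp only: add.assoc)
    note [derivative_intros] = GDERIV_line[OF this] GDERIV_line[OF F[OF small(1)[OF that]]]
    show ?thesis
      unfolding q_def q'_def
      by (rule derivative_eq_intros refl | simp)+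
        (simp add: A.add inner_diff_left inner_add_left)
  qed
  then obtain \<tau> where \<tau>: "0 < \<tau>" "\<tau> < 1" "q 1 - q 0 = q' \<tau>"
    using MVT2[of 0 1 q q'] by auto
  have "\<bar>q' \<tau>\<bar> \<le> norm ((G (x + (u + \<tau> *\<^sub>R w)) - G x - A (u + \<tau> *\<^sub>R w))
     - (G (x + \<tau> *\<^sub>R w) - G x - A (\<tau> *\<^sub>R w))) * norm w"
    unfolding q'_def by (rule Cauchy_Schwarz_ineq2)
  also have "\<dots> \<le> (e * norm (u + \<tau> *\<^sub>R w) + e * norm (\<tau> *\<^sub>R w)) * norm w"
    using G[OF small(1)[of \<tau>]] G[OF small(2)[of \<tau>]] \<tau>
    by (intro mult_right_mono order_trans[OF norm_triangle_ineq4[of "_ - A _"]] add_mono) auto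
  also have "\<dots> \<le> (e * (norm u + norm w) + e * (norm u + norm w)) * norm w"
  proof (intro mult_right_mono add_mono mult_left_mono)
    show "norm (\<tau> *\<^sub>R w) \<le> norm u + norm w"
      using le(1)[of \<tau>] \<tau> norm_ge_zero[of u] by linarith
  qed (use le(2)[of \<tau>] \<tau> \<open>e > 0\<close> in auto)
  finally show ?thesis
    using \<tau>(3) by (simp add: q_def algebra_simps)
qed

text \<open>The second difference of \<open>F\<close> in directions \<open>s *\<^sub>R u\<close> and \<open>s *\<^sub>R w\<close> is symmetric in \<open>u\<close> and
  \<open>w\<close>, and it equals \<open>s\<^sup>2 * inner (A u) w\<close> up to \<open>o(s\<^sup>2)\<close>.\<close>

lemma derivative_of_gradient_selfadjoint:
  fixes F :: "'a::euclidean_space \<Rightarrow> real"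
  assumes "open U" "x \<in> U" and F: "\<And>y. y \<in> U \<Longrightarrow> GDERIV F y :> G y"
    and G: "(G has_derivative A) (at x)"
  shows "inner (A u) w = inner u (A w)"
proof (rule ccontr)
  interpret A: bounded_linear A using G by (rule has_derivative_bounded_linear)
  define M where "M = norm u + norm w"
  assume neq: "inner (A u) w \<noteq> inner u (A w)"
  then have "u \<noteq> 0" by auto
  then have M: "M > 0" by (simp add: M_def add_pos_nonneg)
  \<comment> \<open>Makes the final bound \<open>2 * e * M\<^sup>2\<close> half of the assumed
    discrepancy, which is the contradiction.\<close>
  define e where "e = \<bar>inner (A u) w - inner u (A w)\<bar> / (4 * M\<^sup>2)"
  have "e > 0" using neq M by (simp add: e_def)
  obtain d where d: "d > 0" "\<And>h. norm h < d \<Longrightarrow> x + h \<in> U"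
    "\<And>h. norm h < d \<Longrightarrow> norm (G (x + h) - G x - A h) \<le> e * norm h"
    using gradient_linear_approx[OF assms(1,2) G \<open>e > 0\<close>] by blast
  define s where "s = d / (2 * M)"
  have "s > 0" and sM: "s * M = d / 2"
    using d(1) M by (auto simp: s_def)
  then have s: "s > 0" "norm (s *\<^sub>R u) + norm (s *\<^sub>R w) = s * M" "s * M < d"
    using d(1) by (simp_all add: M_def distrib_left)
  define D where "D = F (x + s *\<^sub>R u + s *\<^sub>R w) - F (x + s *\<^sub>R u) - F (x + s *\<^sub>R w) + F x"
  have "\<bar>D - inner (A (s *\<^sub>R u)) (s *\<^sub>R w)\<bar> \<le> 2 * e * (s * M) * norm (s *\<^sub>R w)"
    unfolding D_def s(2)[symmetric]
    by (rule second_difference_estimate)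
      (use d(3) F[OF d(2)] s \<open>e > 0\<close> A.linear_axioms in auto)
  moreover have "\<bar>D - inner (A (s *\<^sub>R w)) (s *\<^sub>R u)\<bar> \<le> 2 * e * (s * M) * norm (s *\<^sub>R u)"
  proof -
    have "D = F (x + s *\<^sub>R w + s *\<^sub>R u) - F (x + s *\<^sub>R w) - F (x + s *\<^sub>R u) + F x"
      by (simp add: D_def add_ac)
    moreover have "s * M = norm (s *\<^sub>R w) + norm (s *\<^sub>R u)"
      using s(2) by simp
    moreover have "norm (s *\<^sub>R w) + norm (s *\<^sub>R u) < d"
      using s(2,3) by linarith
    ultimately show ?thesis
      using second_difference_estimate[of d F x G A e "s *\<^sub>R w" "s *\<^sub>R u"]
        d(3) F[OF d(2)] \<open>e > 0\<close> A.linear_axioms by auto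
  qed
  ultimately have "\<bar>inner (A (s *\<^sub>R u)) (s *\<^sub>R w) - inner (A (s *\<^sub>R w)) (s *\<^sub>R u)\<bar>
      \<le> 2 * e * (s * M) * norm (s *\<^sub>R w) + 2 * e * (s * M) * norm (s *\<^sub>R u)"
    by linarith
  also have "\<dots> = 2 * e * (s * M) * (norm (s *\<^sub>R u) + norm (s *\<^sub>R w))"
    by (simp only: distrib_left add.commute)
  also have "\<dots> = s\<^sup>2 * (2 * e * M\<^sup>2)"
    unfolding s(2) by (simp add: power2_eq_square)
  finally have "s\<^sup>2 * \<bar>inner (A u) w - inner u (A w)\<bar> \<le> s\<^sup>2 * (2 * e * M\<^sup>2)"
    by (simp add: A.scaleR inner_commute[of u] power2_eq_square abs_mult
        right_diff_distrib[symmetric] mult.assoc[symmetric] flip: abs_mult)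
  then have "\<bar>inner (A u) w - inner u (A w)\<bar> \<le> 2 * e * M\<^sup>2"
    using s(1) by simp
  with neq M show False by (simp add: e_def)
qed

text \<open>Moving from \<open>w\<close> to \<open>w - s *\<^sub>R A w\<close> changes the form by
  \<open>- 2 * s * a\<close> to first order, where \<open>a\<close> is the squared norm of
  \<open>A w\<close>. For small positive \<open>s\<close> this would make the form negative unless
  \<open>a = 0\<close>.\<close>

lemma selfadjoint_psd_null_vector:
  fixes A :: "'a::real_inner \<Rightarrow> 'a"
  assumes "linear A" and sym: "\<And>u w. inner (A u) w = inner u (A w)"
    and psd: "\<And>u. 0 \<le> inner (A u) u" and w: "inner (A w) w = 0"
  shows "A w = 0"
proof -
  interpret A: linear A by fact
  define a b where "a = inner (A w) (A w)" and "b = inner (A (A w)) (A w)"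
  have "b \<ge> 0" unfolding b_def by (rule psd)
  \<comment> \<open>The summand 1 avoids division by zero when \<open>b = 0\<close>; still
    \<open>s * b \<le> a\<close>, so the linear term dominates.\<close>
  define s where "s = a / (b + 1)"
  have "0 \<le> inner (A (w - s *\<^sub>R A w)) (w - s *\<^sub>R A w)" by (rule psd)
  also have "\<dots> = s * (s * b - 2 * a)"
    using sym[of "A w" w] w
    by (simp add: A.diff A.scaleR inner_diff_left inner_diff_right a_def b_def algebra_simps)
  finally have ge: "0 \<le> s * (s * b - 2 * a)" .
  have "a = 0"
  proof (rule ccontr)
    assume "a \<noteq> 0"
    then have "a > 0" by (simp add: a_def)
    then have "s > 0" "s * b \<le> a"
      using \<open>b \<ge> 0\<close> by (auto simp: s_def field_simps)
    with \<open>a > 0\<close> have "s * (s * b - 2 * a) < 0"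
      by (intro mult_pos_neg) auto
    with ge show False by simp
  qed
  then show ?thesis by (simp add: a_def)
qed

section \<open>Strong growth of the sum as a bound on the tilted gap of \<open>g\<close>\<close>

text \<open>The excess of \<open>g\<close> over the affine function of slope \<open>vbar\<close>
  through its value at \<open>xbar\<close>, arranged as in \<open>quadratic_growth\<close>.\<close>

abbreviation tilted_gap :: "('a::euclidean_space \<Rightarrow> ereal) \<Rightarrow> 'a \<Rightarrow> 'a \<Rightarrow> 'a \<Rightarrow> ereal" where
  "tilted_gap g xbar vbar x \<equiv> g x - g xbar - ereal (inner vbar (x - xbar))"

lemma mem_solution_set_iff:
  assumes "\<bar>g xbar\<bar> \<noteq> \<infinity>"
  shows "x \<in> solution_set g xbar vbar \<longleftrightarrow> tilted_gap g xbar vbar x \<le> 0"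
  using assms
  by (cases "g x"; cases "g xbar") (auto simp: solution_set_def inner_diff_right zero_ereal_def)

text \<open>Only \<open>g x\<close> can be infinite, and then both sides have the same truth value;
  all other terms are real and can be moved across, the tilt by \<open>vbar\<close>
  cancelling.\<close>

lemma sum_growth_iff:
  fixes f g :: "'a::euclidean_space \<Rightarrow> ereal"
  assumes "\<bar>f x\<bar> \<noteq> \<infinity>" "\<bar>f xbar\<bar> \<noteq> \<infinity>" "\<bar>g xbar\<bar> \<noteq> \<infinity>"
  shows "ereal r \<le> (f x + g x) - (f xbar + g xbar) \<longleftrightarrow>
    ereal (r - (real_of_ereal (f x) - real_of_ereal (f xbar) + inner vbar (x - xbar)))
      \<le> tilted_gap g xbar vbar x"
  using assms
  by (cases "g x"; cases "g xbar"; cases "f x"; cases "f xbar") auto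

text \<open>The pointwise rearrangement requires \<open>f x\<close> to be finite, which is known on
  \<open>U\<close>; growth is a local property, so a ball inside \<open>U\<close> suffices.\<close>

lemma strong_solution_sum_iff:
  fixes f g :: "'a::euclidean_space \<Rightarrow> ereal"
  assumes "open U" "xbar \<in> U" and f: "\<And>x. x \<in> U \<Longrightarrow> \<bar>f x\<bar> \<noteq> \<infinity>" and g: "\<bar>g xbar\<bar> \<noteq> \<infinity>"
  shows "strong_solution (\<lambda>x. f x + g x) xbar \<longleftrightarrow>
    (\<exists>c \<epsilon>. c > 0 \<and> \<epsilon> > 0 \<and> (\<forall>x\<in>cball xbar \<epsilon>.
      ereal (c * (norm (x - xbar))\<^sup>2 -
        (real_of_ereal (f x) - real_of_ereal (f xbar) + inner vbar (x - xbar)))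
        \<le> tilted_gap g xbar vbar x))" (is "_ \<longleftrightarrow> ?R")
proof -
  let ?strong = "\<lambda>c x. ereal (c * (norm (x - xbar))\<^sup>2) \<le> f x + g x - (f xbar + g xbar)"
  let ?tilted = "\<lambda>c x. ereal (c * (norm (x - xbar))\<^sup>2 -
        (real_of_ereal (f x) - real_of_ereal (f xbar) + inner vbar (x - xbar)))
        \<le> tilted_gap g xbar vbar x"
  obtain \<rho> where \<rho>: "\<rho> > 0" "cball xbar \<rho> \<subseteq> U"
    using assms open_contains_cball by blast
  have iff: "?strong c x \<longleftrightarrow> ?tilted c x" if "x \<in> cball xbar \<rho>" for c x
    using f[of x] f[OF \<open>xbar \<in> U\<close>] g that \<rho>(2) by (intro sum_growth_iff) auto
  \<comment> \<open>Replacing the radius by its minimum with \<open>\<rho>\<close> preserves the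
    constant \<open>c\<close>.\<close>
  have shrink: "(\<exists>c \<epsilon>. c > 0 \<and> \<epsilon> > 0 \<and> (\<forall>x\<in>cball xbar \<epsilon>. P c x)) \<longleftrightarrow>
      (\<exists>c \<epsilon>. c > 0 \<and> \<epsilon> > 0 \<and> (\<forall>x\<in>cball xbar \<epsilon> \<inter> cball xbar \<rho>. P c x))"
    for P :: "real \<Rightarrow> 'a \<Rightarrow> bool"
  proof (intro iffI; elim exE conjE)
    fix c \<epsilon> :: real
    assume "c > 0" "\<epsilon> > 0" "\<forall>x\<in>cball xbar \<epsilon> \<inter> cball xbar \<rho>. P c x"
    then show "\<exists>c \<epsilon>. c > 0 \<and> \<epsilon> > 0 \<and> (\<forall>x\<in>cball xbar \<epsilon>. P c x)"
      using \<rho>(1) by (intro exI[of _ c] exI[of _ "min \<epsilon> \<rho>"]) auto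
  qed blast
  have "xbar \<in> effective_domain (\<lambda>x. f x + g x)"
    using f[OF \<open>xbar \<in> U\<close>] g
    by (cases "f xbar"; cases "g xbar") (auto simp: effective_domain_def)
  then have "strong_solution (\<lambda>x. f x + g x) xbar \<longleftrightarrow>
      (\<exists>c \<epsilon>. c > 0 \<and> \<epsilon> > 0 \<and> (\<forall>x\<in>cball xbar \<epsilon>. ?strong c x))"
    by (simp add: strong_solution_def)
  also have "\<dots> \<longleftrightarrow> (\<exists>c \<epsilon>. c > 0 \<and> \<epsilon> > 0 \<and> (\<forall>x\<in>cball xbar \<epsilon> \<inter> cball xbar \<rho>. ?strong c x))"
    by (rule shrink)
  also have "\<dots> \<longleftrightarrow> (\<exists>c \<epsilon>. c > 0 \<and> \<epsilon> > 0 \<and> (\<forall>x\<in>cball xbar \<epsilon> \<inter> cball xbar \<rho>. ?tilted c x))"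
    by (intro ex_cong1 conj_cong ball_cong refl iff) simp
  also have "\<dots> \<longleftrightarrow> ?R"
    by (rule shrink[symmetric])
  finally show ?thesis .
qed

section \<open>Growth and curvature along contingent directions\<close>

text \<open>On the points \<open>xbar + t k *\<^sub>R ws k\<close> realising \<open>w\<close> the
  gap is nonpositive, so growth bounds the second-order remainder of \<open>F\<close> from below.
  Stationarity makes the tilt the first-order Taylor term; dividing by \<open>(t k)\<^sup>2\<close>
  and passing to the limit gives the bound.\<close>

lemma tilted_growth_curvature_bound:
  fixes F :: "'a::euclidean_space \<Rightarrow> real" and g :: "'a \<Rightarrow> ereal"
  assumes "open U" "xbar \<in> U" and F: "\<And>y. y \<in> U \<Longrightarrow> GDERIV F y :> G y"
    and G: "(G has_derivative A) (at xbar)" "vbar = - G xbar"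
    and g: "\<bar>g xbar\<bar> \<noteq> \<infinity>"
    and "\<epsilon> > 0" and growth: "\<And>x. x \<in> cball xbar \<epsilon> \<Longrightarrow>
      ereal (c * (norm (x - xbar))\<^sup>2 - (F x - F xbar + inner vbar (x - xbar)))
        \<le> tilted_gap g xbar vbar x"
    and w: "w \<in> contingent_cone (solution_set g xbar vbar) xbar"
  shows "c * (norm w)\<^sup>2 \<le> inner (A w) w / 2"
proof -
  obtain t ws where t: "\<And>k. t k > (0::real)" "t \<longlonglongrightarrow> 0" and ws: "ws \<longlonglongrightarrow> w"
    and mem: "\<And>k::nat. xbar + t k *\<^sub>R ws k \<in> solution_set g xbar vbar"
    using w unfolding contingent_cone_def by blast
  let ?q = "\<lambda>k. (F (xbar + t k *\<^sub>R ws k) - F xbar - inner (G xbar) (t k *\<^sub>R ws k)) / (t k)\<^sup>2"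
  have q: "?q \<longlonglongrightarrow> inner (A w) w / 2"
    by (rule second_order_quotient_tendsto[OF assms(1,2) F G(1) t ws])
  have "(\<lambda>k. t k *\<^sub>R ws k) \<longlonglongrightarrow> 0"
    using tendsto_scaleR[OF t(2) ws] by simp
  then have "\<forall>\<^sub>F k in sequentially. norm (t k *\<^sub>R ws k) < \<epsilon>"
    using \<open>\<epsilon> > 0\<close> by (auto dest: tendstoD simp: dist_norm)
  then have "\<forall>\<^sub>F k in sequentially. c * (norm (ws k))\<^sup>2 \<le> ?q k"
  proof eventually_elim
    case (elim k)
    let ?x = "xbar + t k *\<^sub>R ws k"
    have "?x \<in> cball xbar \<epsilon>" using elim by (simp add: dist_norm)
    from order_trans[OF growth[OF this]] mem[of k]
    have "c * (norm (t k *\<^sub>R ws k))\<^sup>2 \<le> F ?x - F xbar + inner vbar (t k *\<^sub>R ws k)"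
      by (fastforce simp: mem_solution_set_iff[of g, OF g] zero_ereal_def)
    then show ?case
      using t(1)[of k] by (simp add: G(2) power_mult_distrib pos_le_divide_eq mult_ac)
  qed
  moreover have "(\<lambda>k. c * (norm (ws k))\<^sup>2) \<longlonglongrightarrow> c * (norm w)\<^sup>2"
    by (intro tendsto_intros ws)
  ultimately show ?thesis
    using q by (intro tendsto_le[OF trivial_limit_sequentially q])
qed

text \<open>If strong growth fails, normalised violating directions subconverge to some unit vector
  \<open>w\<close>. Quadratic growth of \<open>g\<close> bounds the squared distance to the solution set by
  \<open>- t\<^sup>2 * inner (A w) w + o(t\<^sup>2)\<close>, so positive semidefiniteness makes it \<open>o(t\<^sup>2)\<close>: this puts
  \<open>w\<close> in the contingent cone and forces \<open>inner (A w) w = 0\<close>.\<close>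

lemma tilted_growth_failure_direction:
  fixes F :: "'a::euclidean_space \<Rightarrow> real" and g :: "'a \<Rightarrow> ereal"
  assumes "open U" "xbar \<in> U" and F: "\<And>y. y \<in> U \<Longrightarrow> GDERIV F y :> G y"
    and G: "(G has_derivative A) (at xbar)" "vbar = - G xbar"
    and g: "\<bar>g xbar\<bar> \<noteq> \<infinity>"
    and psd: "\<And>w. 0 \<le> inner (A w) w"
    and qg: "quadratic_growth g xbar vbar"
    and fail: "\<not> (\<exists>c \<epsilon>. c > 0 \<and> \<epsilon> > 0 \<and> (\<forall>x\<in>cball xbar \<epsilon>.
      ereal (c * (norm (x - xbar))\<^sup>2 - (F x - F xbar + inner vbar (x - xbar)))
        \<le> tilted_gap g xbar vbar x))"
  obtains w where "w \<in> contingent_cone (solution_set g xbar vbar) xbar" "norm w = 1"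
    "inner (A w) w = 0"
proof -
  let ?S = "solution_set g xbar vbar"
  obtain \<epsilon> \<delta> \<kappa> where pos: "\<epsilon> > 0" "\<delta> > 0" "\<kappa> > 0" and growth:
    "\<And>x. x \<in> cball xbar \<epsilon> \<Longrightarrow> tilted_gap g xbar vbar x < ereal \<delta> \<Longrightarrow>
       ereal (\<kappa> / 2 * (infdist x ?S)\<^sup>2) \<le> tilted_gap g xbar vbar x"
    using qg unfolding quadratic_growth_def by blast
  \<comment> \<open>Failure is used with constant and radius both \<open>1 / Suc n\<close>, so the
    violating points tend to \<open>xbar\<close> while the coefficient of the quadratic term
    vanishes.\<close>
  have "\<exists>x\<in>cball xbar (1 / Suc n). tilted_gap g xbar vbar x <
     ereal (1 / Suc n * (norm (x - xbar))\<^sup>2 - (F x - F xbar + inner vbar (x - xbar)))" for n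
    using fail unfolding not_ex de_Morgan_conj not_all not_le bex_simps
    by (metis (no_types, lifting) linorder_not_le of_nat_0_less_iff zero_less_Suc zero_less_divide_1_iff)
  then obtain y where y: "\<And>n. norm (y n - xbar) \<le> 1 / Suc n" "\<And>n. tilted_gap g xbar vbar (y n) <
     ereal (1 / Suc n * (norm (y n - xbar))\<^sup>2 - (F (y n) - F xbar + inner vbar (y n - xbar)))"
    unfolding mem_cball dist_norm norm_minus_commute[of xbar] Bex_def by metis
  \<comment> \<open>At \<open>xbar\<close> both sides of the strict violation are 0; hence the
    directions can be normalised.\<close>
  have ne: "y n \<noteq> xbar" for n
    using y(2)[of n] g by (cases "g xbar") (auto simp: zero_ereal_def)
  define u where "u n = (y n - xbar) /\<^sub>R norm (y n - xbar)" for n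
  have "u n \<in> sphere 0 1" for n
    using ne[of n] by (simp add: u_def)
  then obtain w r where w: "w \<in> sphere 0 1" and r: "strict_mono r" and lim: "(u \<circ> r) \<longlonglongrightarrow> w"
    using compact_sphere[of "0::'a" 1] unfolding compact_def by blast
  define t where "t k = norm (y (r k) - xbar)" for k
  have t: "t k > 0" for k using ne by (simp add: t_def)
  define ws where "ws = u \<circ> r"
  have ws: "ws \<longlonglongrightarrow> w" using lim unfolding ws_def .
  have yr: "y (r k) = xbar + t k *\<^sub>R ws k" for k
    using ne[of "r k"] by (simp add: t_def ws_def u_def)
  have inv: "(\<lambda>k. 1 / real (Suc (r k))) \<longlonglongrightarrow> 0"
    using LIMSEQ_subseq_LIMSEQ[OF LIMSEQ_Suc[OF lim_1_over_n] r] by (simp add: o_def)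
  have t0: "t \<longlonglongrightarrow> 0"
    by (rule tendsto_sandwich[OF _ _ tendsto_const inv])
      (use y(1) in \<open>auto simp: t_def\<close>)
  define q where
    "q k = (F (xbar + t k *\<^sub>R ws k) - F xbar - inner (G xbar) (t k *\<^sub>R ws k)) / (t k)\<^sup>2" for k
  have q: "q \<longlonglongrightarrow> inner (A w) w / 2"
    unfolding q_def by (rule second_order_quotient_tendsto[OF assms(1,2) F G(1) t t0 ws])
  \<comment> \<open>The violated bound measured in units of \<open>(t k)\<^sup>2\<close>.\<close>
  define p where "p k = 1 / real (Suc (r k)) - q k" for k
  have p: "p \<longlonglongrightarrow> - (inner (A w) w / 2)"
    unfolding p_def using tendsto_diff[OF inv q] by simp
  have gap: "tilted_gap g xbar vbar (y (r k)) < ereal (p k * (t k)\<^sup>2)" for k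
  proof -
    have "q k * (t k)\<^sup>2 = F (y (r k)) - F xbar + inner vbar (y (r k) - xbar)"
      using t[of k] by (simp add: q_def G(2) yr)
    then have "p k * (t k)\<^sup>2 = 1 / Suc (r k) * (norm (y (r k) - xbar))\<^sup>2
       - (F (y (r k)) - F xbar + inner vbar (y (r k) - xbar))"
      by (simp add: p_def left_diff_distrib flip: t_def)
    then show ?thesis using y(2)[of "r k"] by simp
  qed
  \<comment> \<open>Distance to the solution set relative to the step length; \<open>w\<close> is
    shown to be contingent by proving that \<open>D\<close> tends to 0.\<close>
  define D where "D k = infdist (y (r k)) ?S / t k" for k
  \<comment> \<open>The upper bound on the gap tends to 0, so the threshold \<open>\<delta>\<close>
    in quadratic growth is eventually met.\<close>
  have "(\<lambda>k. p k * (t k)\<^sup>2) \<longlonglongrightarrow> 0"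
    using tendsto_mult[OF p tendsto_power[OF t0, of 2]] by simp
  then have "\<forall>\<^sub>F k in sequentially. p k * (t k)\<^sup>2 < \<delta>" "\<forall>\<^sub>F k in sequentially. t k < \<epsilon>"
    using order_tendstoD(2) t0 pos by blast+
  then have D: "\<forall>\<^sub>F k in sequentially. (D k)\<^sup>2 \<le> 2 / \<kappa> * p k"
  proof eventually_elim
    case (elim k)
    have "y (r k) \<in> cball xbar \<epsilon>"
      using elim(2) by (simp add: t_def dist_norm norm_minus_commute)
    moreover have "tilted_gap g xbar vbar (y (r k)) < ereal \<delta>"
      using gap[of k] elim(1) by (metis ereal_less(2) less_ereal.simps(1) order.strict_trans)
    ultimately have "ereal (\<kappa> / 2 * (infdist (y (r k)) ?S)\<^sup>2) < ereal (p k * (t k)\<^sup>2)"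
      using growth gap[of k] le_less_trans by blast
    then show ?case
      using t[of k] pos(3) by (simp add: D_def power_divide field_simps)
  qed
  have lim2: "(\<lambda>k. 2 / \<kappa> * p k) \<longlonglongrightarrow> 2 / \<kappa> * - (inner (A w) w / 2)"
    by (intro tendsto_mult tendsto_const p)
  \<comment> \<open>Squares are nonnegative, so the limit of their upper bounds is too; positive
    semidefiniteness gives the opposite sign.\<close>
  have "0 \<le> 2 / \<kappa> * - (inner (A w) w / 2)"
    by (rule tendsto_lowerbound[OF lim2 _ trivial_limit_sequentially])
      (use D in eventually_elim, use order_trans zero_le_power2 in blast)
  then have w0: "inner (A w) w = 0"
    using psd[of w] pos(3) by (simp add: field_simps mult_le_0_iff zero_le_mult_iff)
  have "(\<lambda>k. (D k)\<^sup>2) \<longlonglongrightarrow> 0"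
    by (rule tendsto_sandwich[OF _ D tendsto_const]) (use lim2 w0 in auto)
  from tendsto_real_sqrt[OF this] have D0: "D \<longlonglongrightarrow> 0"
    using t by (simp add: D_def[abs_def] infdist_nonneg less_imp_le)
  have "xbar \<in> ?S" by (simp add: solution_set_def)
  then have nonempty: "?S \<noteq> {}" by blast
  \<comment> \<open>Near-minimisers of the distance suffice: the slack
    \<open>t k / Suc (r k)\<close> vanishes even after division by \<open>t k\<close>.\<close>
  have "\<exists>z\<in>?S. dist (y (r k)) z < infdist (y (r k)) ?S + t k / Suc (r k)" for k
    unfolding infdist_notempty[OF nonempty]
    by (subst cINF_less_iff[OF nonempty, symmetric]) (use t[of k] in auto)
  then obtain z where z: "\<And>k. z k \<in> ?S"
    "\<And>k. dist (y (r k)) (z k) < infdist (y (r k)) ?S + t k / Suc (r k)"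
    by metis
  \<comment> \<open>Directions from \<open>xbar\<close> to points of the solution set with the same
    step lengths; they differ from \<open>ws\<close> by a null sequence, so they also tend to
    \<open>w\<close>.\<close>
  define zs where "zs k = (z k - xbar) /\<^sub>R t k" for k
  have zx: "z k = xbar + t k *\<^sub>R zs k" for k
    using t[of k] by (simp add: zs_def)
  have close: "norm (zs k - ws k) \<le> D k + 1 / real (Suc (r k))" for k
  proof -
    have "t k * norm (zs k - ws k) = dist (y (r k)) (z k)"
      using t[of k] by (simp add: zx yr dist_norm norm_minus_commute scaleR_diff_right[symmetric])
    also have "\<dots> \<le> t k * (D k + 1 / real (Suc (r k)))"
      using z(2)[of k] t[of k] by (simp add: D_def distrib_left)
    finally show ?thesis using t[of k] by simp
  qed
  have "(\<lambda>k. zs k - ws k) \<longlonglongrightarrow> 0"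
  proof (rule Lim_null_comparison[OF always_eventually])
    show "(\<lambda>k. D k + 1 / real (Suc (r k))) \<longlonglongrightarrow> 0"
      using tendsto_add[OF D0 inv] by simp
  qed (use close in blast)
  from tendsto_add[OF this ws] have "zs \<longlonglongrightarrow> w" by simp
  then have "w \<in> contingent_cone ?S xbar"
    unfolding contingent_cone_def using t t0 z(1) zx by auto
  then show thesis using w w0 that by simp
qed

theorem theorem3p3:
  fixes f g :: "'a::euclidean_space \<Rightarrow> ereal"
    and xbar vbar :: 'a
  assumes "proper_fun f" and "proper_fun g"
    and "interior (effective_domain f) \<inter> effective_domain g \<noteq> {}"
    and "twice_continuously_differentiable_on (real_of_ereal \<circ> f) (interior (effective_domain f))"
    and "lower_semicontinuous g"
    and "xbar \<in> interior (effective_domain f) \<inter> effective_domain g"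
    and "vbar = - gradient (real_of_ereal \<circ> f) xbar"
    and "vbar \<in> limiting_subdifferential g xbar"
  shows
    "(strong_solution (\<lambda>x. f x + g x) xbar \<longrightarrow>
        (\<forall>w \<in> contingent_cone (solution_set g xbar vbar) xbar - {0}.
           inner (blinfun_apply (hessian (real_of_ereal \<circ> f) xbar) w) w > 0)) \<and>
     (quadratic_growth g xbar vbar \<and> positive_semidefinite (hessian (real_of_ereal \<circ> f) xbar) \<longrightarrow>
        (strong_solution (\<lambda>x. f x + g x) xbar \<longleftrightarrow>
           Ker (hessian (real_of_ereal \<circ> f) xbar) \<inter> contingent_cone (solution_set g xbar vbar) xbar
             = {0}))"
proof -
  let ?F = "real_of_ereal \<circ> f" and ?U = "interior (effective_domain f)"
  let ?A = "blinfun_apply (hessian ?F xbar)"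
  let ?T = "contingent_cone (solution_set g xbar vbar) xbar"
  have U: "open ?U" "xbar \<in> ?U" using assms(6) by auto
  have f: "\<bar>f x\<bar> \<noteq> \<infinity>" if "x \<in> ?U" for x
    using that interior_subset[of "effective_domain f"] assms(1)
    by (auto simp: effective_domain_def proper_fun_def)
  have gm: "g x \<noteq> -\<infinity>" for x
    using assms(2) by (simp add: proper_fun_def)
  have g: "\<bar>g xbar\<bar> \<noteq> \<infinity>"
    using gm[of xbar] assms(6) by (auto simp: effective_domain_def)
  have F: "GDERIV ?F y :> gradient ?F y" if "y \<in> ?U" for y
    using assms(4) that by (intro gderiv_gradient) (simp add: twice_continuously_differentiable_on_def)
  have A: "(gradient ?F has_derivative ?A) (at xbar)"
    using assms(4) U by (intro has_derivative_hessian) (simp add: twice_continuously_differentiable_on_def)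
  have strong_iff: "strong_solution (\<lambda>x. f x + g x) xbar \<longleftrightarrow>
    (\<exists>c \<epsilon>. c > 0 \<and> \<epsilon> > 0 \<and> (\<forall>x\<in>cball xbar \<epsilon>.
      ereal (c * (norm (x - xbar))\<^sup>2 - (?F x - ?F xbar + inner vbar (x - xbar)))
        \<le> tilted_gap g xbar vbar x))"
    unfolding o_apply using U f g by (rule strong_solution_sum_iff)
  have curvature: "inner (?A w) w > 0"
    if strong: "strong_solution (\<lambda>x. f x + g x) xbar" and w: "w \<in> ?T" "w \<noteq> 0" for w
  proof -
    obtain c \<epsilon> where c: "c > 0" "\<epsilon> > 0" "\<And>x. x \<in> cball xbar \<epsilon> \<Longrightarrow>
      ereal (c * (norm (x - xbar))\<^sup>2 - (?F x - ?F xbar + inner vbar (x - xbar)))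
        \<le> tilted_gap g xbar vbar x"
      using strong unfolding strong_iff by blast
    have "0 < c * (norm w)\<^sup>2" using c(1) w(2) by simp
    also have "\<dots> \<le> inner (?A w) w / 2"
      by (rule tilted_growth_curvature_bound[OF U F A assms(7) g c(2,3) w(1)])
    finally show ?thesis by simp
  qed
  \<comment> \<open>Reduces the kernel condition to excluding nonzero common vectors.\<close>
  have zero: "0 \<in> Ker (hessian ?F xbar) \<inter> ?T"
  proof -
    have "xbar \<in> solution_set g xbar vbar" by (simp add: solution_set_def)
    moreover have "(\<lambda>k. 1 / real (Suc k)) \<longlonglongrightarrow> 0"
      using LIMSEQ_Suc[OF lim_1_over_n] by simp
    ultimately have "0 \<in> ?T"
      unfolding contingent_cone_def mem_Collect_eq
      by (intro exI[of _ "\<lambda>k. 1 / real (Suc k)"] exI[of _ "\<lambda>_. 0::'a"]) simp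
    then show ?thesis by (simp add: Ker_def)
  qed
  have "strong_solution (\<lambda>x. f x + g x) xbar \<longleftrightarrow> Ker (hessian ?F xbar) \<inter> ?T = {0}"
    if qg: "quadratic_growth g xbar vbar" and psd: "positive_semidefinite (hessian ?F xbar)"
  proof
    assume "strong_solution (\<lambda>x. f x + g x) xbar"
    then show "Ker (hessian ?F xbar) \<inter> ?T = {0}"
      using zero curvature by (fastforce simp: Ker_def)
  next
    assume ker: "Ker (hessian ?F xbar) \<inter> ?T = {0}"
    show "strong_solution (\<lambda>x. f x + g x) xbar"
    proof (rule ccontr)
      have psd': "0 \<le> inner (?A w) w" for w
        using psd by (simp add: positive_semidefinite_def)
      assume "\<not> strong_solution (\<lambda>x. f x + g x) xbar"
      then obtain w where w: "w \<in> ?T" "norm w = 1" "inner (?A w) w = 0"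
        using tilted_growth_failure_direction[OF U F A assms(7) g psd' qg]
        unfolding strong_iff by blast
      \<comment> \<open>Symmetry of the Hessian upgrades zero curvature along \<open>w\<close> to
        membership in the kernel.\<close>
      have "?A w = 0"
        by (rule selfadjoint_psd_null_vector
            [OF _ derivative_of_gradient_selfadjoint[OF U F A] psd' w(3)])
          (simp add: blinfun.bounded_linear_right bounded_linear.linear)
      then have "w \<in> Ker (hessian ?F xbar) \<inter> ?T"
        using w(1) by (simp add: Ker_def)
      with ker w(2) show False by auto
    qed
  qed
  with curvature show ?thesis by blast
qed

end
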